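(* Suppose the feature model and the response model described in the context hold, with limiting quantities $H,G,\rho^2,\sigma^2$, and let $\phi\in(0,\infty)$. For any $\bar\phi_s\in[\phi,+\infty]$ there exists $\bar\lambda\ge0$ such that $$\mathscr R^{0}_\infty(\phi,\bar\phi_s)=\mathscr R^{\bar\lambda}_\infty(\phi,\phi).$$ Further, $\mathscr R^{\lambda}_\infty(\phi,\phi_s)$ remains constant as $(\lambda,\phi_s)$ varies on the line segment $$(1-\theta)\cdot(\bar\lambda,\phi)+\theta\cdot(0,\bar\phi_s),\qquad\text{for all }\theta\in[0,1].$$
   Context: Data: $\mathcal D_n=\{(x_j,y_j):j\in[n]\}$ are i.i.d. random vectors in $\mathbb R^p\times\mathbb R$; $X\in\mathbb R^{n\times p}$ has rows $x_j^\top$ and $y\in\mathbb R^n$ has entries $y_j$. Feature model: $X=Z\Sigma^{1/2}$, where $Z\in\mathbb R^{n\times p}$ has i.i.d. entries with mean $0$, variance $1$, and bounded moments of order $4+\delta$ for some $\delta>0$; $\Sigma\in\mathbb R^{p\times p}$ is deterministic and symmetric with eigenvalues uniformly bounded between $r_{\min}>0$ and $r_{\max}<\infty$. Let $\Sigma=\sum_{j=1}^p r_jw_jw_j^\top$ be the eigenvalue decomposition, with $w_j$ normalized. The empirical spectral distribution $H_p(r)=p^{-1}\sum_{i=1}^p\mathbf 1\{r_i\le r\}$ converges weakly, almost surely with respect to $X$, to a deterministic distribution $H$. Response model: $y=X\beta_0+\epsilon$, where $\beta_0\in\mathbb R^p$ is an unknown signal vector with uniformly bounded $\ell_2$-norm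 and $\lim_{p\to\infty}\|\beta_0\|_2^2=\rho^2$; $\epsilon$ is an unobserved error vector independent of $X$ with mean $0$, variance $\sigma^2$ and bounded moment of order $4+\delta$ for some $\delta>0$. The distribution $G_p(r)=\|\beta_0\|_2^{-2}\sum_{i=1}^p(\beta_0^\top w_i)^2\mathbf 1\{r_i\le r\}$ converges weakly, almost surely with respect to $X$, to a deterministic distribution $G$. Fixed-point quantities: for $\lambda>0$, $\theta>0$, $v(-\lambda;\theta)$ is the unique nonnegative solution of $$v(-\lambda;\theta)^{-1}=\lambda+\theta\int\frac{r}{1+v(-\lambda;\theta)r}\,dH(r).$$ For $\lambda=0$: $v(0;\theta)=\lim_{\lambda\to0^+}v(-\lambda;\theta)$ if $\theta>1$ and $v(0;\theta)=+\infty$ otherwise. For $\theta=+\infty$, $v(-\lambda;+\infty)=\lim_{\theta\to\infty}v(-\lambda;\theta)=0$. For $\vartheta\le\theta$ set $$\tilde v(-\lambda;\vartheta,\theta)=\frac{\vartheta\int r^2(1+v(-\lambda;\theta)r)^{-2}dH(r)}{v(-\lambda;\theta)^{-2}-\vartheta\int r^2(1+v(-\lambda;\theta)r)^{-2}dH(r)},\qquad \tilde c(-\lambda;\theta)=\int\frac{r}{(1+v(-\lambda;\theta)r)^2}dG(r).$$ Asymptotic risk of the full ridge ensemble with penalty $\lambda\ge0$, data aspect ratio $\phi$ and subsample aspect ratio $\phi_s\in[\phi,\infty]$: $$\mathscr R^\lambda_\infty(\phi,\phi_s)=\sigma^2+\rho^2\bigl(1+\tilde v(-\lambda;\phi,\phi_s)\bigr)\tilde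 c(-\lambda;\phi_s)+\sigma^2\,\tilde v(-\lambda;\phi,\phi_s).$$ Expressions where $v\in\{0,+\infty\}$ are understood as the corresponding limits. This is the deterministic limit, as $k,n,p\to\infty$, $p/n\to\phi$, $p/k\to\phi_s$, of the squared prediction risk (conditional on $\mathcal D_n$, at an independent test point from the same distribution) of the average, over all $k$-element subsets $I\subseteq[n]$, of the ridge estimators with penalty $\lambda$ fitted on $\{(x_j,y_j):j\in I\}$, namely the minimizers over $\beta\in\mathbb R^p$ of $\sum_{j\in I}(y_j-x_j^\top\beta)^2/k+\lambda\|\beta\|_2^2$ (for $\lambda=0$, the ridgeless estimator obtained as $\lambda\to0^+$).
   Formalization: For φ̄_s=+∞ the penalty λ̄ may be +∞ (risk there is the limit λ→∞, with v=0), since for ρ=0, σ>0 no finite λ̄ gives the null risk σ²; for every finite φ̄_s, λ̄ is finite as stated. *)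

theory Defs
  imports "HOL-Probability.Probability" "Jordan_Normal_Form.Matrix"
begin

(* Dimensions grow along the sequence, so vectors and matrices are the
   dynamically sized ones of Jordan_Normal_Form. *)
unbundle no vec_syntax
unbundle no inner_syntax


section \<open>Spectral objects\<close>

text \<open>\<open>spectral_mat f d r w\<close> is \<open>\<Sum>j<d. f (r j) * w j * (w j)\<^sup>T\<close>: for
  \<open>f x = x\<close> the matrix with eigenpairs \<open>(r j, w j)\<close>, for \<open>f = sqrt\<close> its square root.\<close>

definition spectral_mat ::
  "(real \<Rightarrow> real) \<Rightarrow> nat \<Rightarrow> (nat \<Rightarrow> real) \<Rightarrow> (nat \<Rightarrow> real vec) \<Rightarrow> real mat" where
  "spectral_mat f d r w = mat d d (\<lambda>(a, b). \<Sum>j<d. f (r j) * (w j $ a) * (w j $ b))"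

definition emp_spectral_cdf :: "nat \<Rightarrow> (nat \<Rightarrow> real) \<Rightarrow> real \<Rightarrow> real" where
  "emp_spectral_cdf d r x = inverse (real d) * (\<Sum>i<d. if r i \<le> x then 1 else 0)"

definition signal_spectral_cdf ::
  "real vec \<Rightarrow> nat \<Rightarrow> (nat \<Rightarrow> real) \<Rightarrow> (nat \<Rightarrow> real vec) \<Rightarrow> real \<Rightarrow> real" where
  "signal_spectral_cdf b d r w x =
     inverse (b \<bullet> b) * (\<Sum>i<d. if r i \<le> x then (b \<bullet> w i)\<^sup>2 else 0)"


section \<open>Feature and response models\<close>

text \<open>Everything is indexed by the sample size \<open>n\<close>; the dimension is \<open>p n\<close>. The random
  matrices and vectors are functions on one probability space \<open>M\<close>. The moment bounds are
  uniform in \<open>n\<close>. As \<open>Sig\<close> and \<open>\<beta>0\<close> are deterministic, the \<open>AE\<close> in the two weak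
  convergence assumptions is vacuous. Independence of \<open>\<epsilon>\<close> and \<open>X\<close> is that of the generated
  sigma-algebras, since \<open>indep_var\<close> needs both variables to have the same type.\<close>

locale feature_model = prob_space M
  for M :: "'a measure"
    and p :: "nat \<Rightarrow> nat"
    and Z :: "nat \<Rightarrow> 'a \<Rightarrow> real mat"
    and Sig :: "nat \<Rightarrow> real mat"
    and r :: "nat \<Rightarrow> nat \<Rightarrow> real"
    and w :: "nat \<Rightarrow> nat \<Rightarrow> real vec"
    and X :: "nat \<Rightarrow> 'a \<Rightarrow> real mat"
    and H :: "real measure" +
  assumes p_at_top: "filterlim p at_top sequentially"
    and Z_carrier: "\<And>n \<omega>. Z n \<omega> \<in> carrier_mat n (p n)"
    and Z_indep: "\<And>n. indep_vars (\<lambda>_. borel) (\<lambda>(i, j) \<omega>. Z n \<omega> $$ (i, j)) ({..<n} \<times> {..<p n})"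
    and Z_ident: "\<And>n i j i' j'. \<lbrakk>i < n; j < p n; i' < n; j' < p n\<rbrakk> \<Longrightarrow>
        distr M borel (\<lambda>\<omega>. Z n \<omega> $$ (i, j)) = distr M borel (\<lambda>\<omega>. Z n \<omega> $$ (i', j'))"
    and Z_mean: "\<And>n i j. \<lbrakk>i < n; j < p n\<rbrakk> \<Longrightarrow> expectation (\<lambda>\<omega>. Z n \<omega> $$ (i, j)) = 0"
    and Z_var: "\<And>n i j. \<lbrakk>i < n; j < p n\<rbrakk> \<Longrightarrow> variance (\<lambda>\<omega>. Z n \<omega> $$ (i, j)) = 1"
    and Z_moment: "\<exists>\<delta>>0. \<exists>C. \<forall>n. \<forall>i<n. \<forall>j<p n.
        integrable M (\<lambda>\<omega>. \<bar>Z n \<omega> $$ (i, j)\<bar> powr (4 + \<delta>)) \<and>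
        expectation (\<lambda>\<omega>. \<bar>Z n \<omega> $$ (i, j)\<bar> powr (4 + \<delta>)) \<le> C"
    and Sig_carrier: "\<And>n. Sig n \<in> carrier_mat (p n) (p n)"
    and Sig_symmetric: "\<And>n. transpose_mat (Sig n) = Sig n"
    and w_carrier: "\<And>n j. j < p n \<Longrightarrow> w n j \<in> carrier_vec (p n)"
    and w_orthonormal: "\<And>n i j. \<lbrakk>i < p n; j < p n\<rbrakk> \<Longrightarrow> w n i \<bullet> w n j = (if i = j then 1 else 0)"
    and Sig_spectral: "\<And>n. Sig n = spectral_mat (\<lambda>x. x) (p n) (r n) (w n)"
    and r_bounds: "\<exists>r_min>0. \<exists>r_max. \<forall>n. \<forall>j<p n. r_min \<le> r n j \<and> r n j \<le> r_max"
    and X_eq: "\<And>n \<omega>. X n \<omega> = Z n \<omega> * spectral_mat sqrt (p n) (r n) (w n)"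
    and H_distribution: "real_distribution H"
    and H_limit: "AE \<omega> in M. weak_conv (\<lambda>n. emp_spectral_cdf (p n) (r n)) (cdf H)"

locale response_model = feature_model M p Z Sig r w X H
  for M :: "'a measure"
    and p :: "nat \<Rightarrow> nat"
    and Z :: "nat \<Rightarrow> 'a \<Rightarrow> real mat"
    and Sig :: "nat \<Rightarrow> real mat"
    and r :: "nat \<Rightarrow> nat \<Rightarrow> real"
    and w :: "nat \<Rightarrow> nat \<Rightarrow> real vec"
    and X :: "nat \<Rightarrow> 'a \<Rightarrow> real mat"
    and H :: "real measure" +
  fixes \<beta>0 :: "nat \<Rightarrow> real vec"
    and \<epsilon> :: "nat \<Rightarrow> 'a \<Rightarrow> real vec"
    and y :: "nat \<Rightarrow> 'a \<Rightarrow> real vec"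
    and G :: "real measure"
    and \<rho> \<sigma> :: real
  assumes \<beta>0_carrier: "\<And>n. \<beta>0 n \<in> carrier_vec (p n)"
    and \<beta>0_bounded: "\<exists>C. \<forall>n. sqrt (\<beta>0 n \<bullet> \<beta>0 n) \<le> C"
    and \<beta>0_limit: "(\<lambda>n. \<beta>0 n \<bullet> \<beta>0 n) \<longlonglongrightarrow> \<rho>\<^sup>2"
    and \<epsilon>_carrier: "\<And>n \<omega>. \<epsilon> n \<omega> \<in> carrier_vec n"
    and \<epsilon>_indep: "\<And>n. indep_vars (\<lambda>_. borel) (\<lambda>i \<omega>. \<epsilon> n \<omega> $ i) {..<n}"
    and \<epsilon>_ident: "\<And>n i i'. \<lbrakk>i < n; i' < n\<rbrakk> \<Longrightarrow>
        distr M borel (\<lambda>\<omega>. \<epsilon> n \<omega> $ i) = distr M borel (\<lambda>\<omega>. \<epsilon> n \<omega> $ i')"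
    and \<epsilon>_indep_X: "\<And>n. indep_set
        (sets (vimage_algebra (space M)
           (\<lambda>\<omega>. \<lambda>ij\<in>{..<n} \<times> {..<p n}. X n \<omega> $$ ij) (Pi\<^sub>M ({..<n} \<times> {..<p n}) (\<lambda>_. borel))))
        (sets (vimage_algebra (space M)
           (\<lambda>\<omega>. \<lambda>i\<in>{..<n}. \<epsilon> n \<omega> $ i) (Pi\<^sub>M {..<n} (\<lambda>_. borel))))"
    and \<epsilon>_mean: "\<And>n i. i < n \<Longrightarrow> expectation (\<lambda>\<omega>. \<epsilon> n \<omega> $ i) = 0"
    and \<epsilon>_var: "\<And>n i. i < n \<Longrightarrow> variance (\<lambda>\<omega>. \<epsilon> n \<omega> $ i) = \<sigma>\<^sup>2"
    and \<epsilon>_moment: "\<exists>\<delta>>0. \<exists>C. \<forall>n. \<forall>i<n.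
        integrable M (\<lambda>\<omega>. \<bar>\<epsilon> n \<omega> $ i\<bar> powr (4 + \<delta>)) \<and>
        expectation (\<lambda>\<omega>. \<bar>\<epsilon> n \<omega> $ i\<bar> powr (4 + \<delta>)) \<le> C"
    and y_eq: "\<And>n \<omega>. y n \<omega> = X n \<omega> *\<^sub>v \<beta>0 n + \<epsilon> n \<omega>"
    and G_distribution: "real_distribution G"
    and G_limit: "AE \<omega> in M. weak_conv (\<lambda>n. signal_spectral_cdf (\<beta>0 n) (p n) (r n) (w n)) (cdf G)"


section \<open>Fixed-point quantities\<close>

text \<open>The penalty argument \<open>lam\<close> stands for \<open>\<lambda>\<close>, so \<open>fp_v H lam \<theta>\<close> is \<open>v(-\<lambda>;\<theta>)\<close>. For
  \<open>lam > 0\<close> and \<open>H\<close> carried by the positive reals, the right-hand side is positive, so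
  \<open>inverse 0 = 0\<close> does not make \<open>v = 0\<close> a solution.\<close>

definition fp_v_pos :: "real measure \<Rightarrow> real \<Rightarrow> real \<Rightarrow> real" where
  "fp_v_pos H lam \<theta> =
     (THE v. 0 \<le> v \<and> inverse v = lam + \<theta> * (LINT r|H. r / (1 + v * r)))"

definition fp_v_nonneg :: "real measure \<Rightarrow> real \<Rightarrow> real \<Rightarrow> ereal" where
  "fp_v_nonneg H lam \<theta> =
     (if lam > 0 then ereal (fp_v_pos H lam \<theta>)
      else if \<theta> > 1 then Lim (at_right 0) (\<lambda>l. ereal (fp_v_pos H l \<theta>))
      else \<infinity>)"

text \<open>Infinite arguments are read as limits, first in the aspect ratio, then in the
  penalty; both limits are \<open>0\<close>. The infinite penalty is the null predictor, which is the
  ridge counterpart of an infinite subsample aspect ratio.\<close>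

definition fp_v_aspect :: "real measure \<Rightarrow> real \<Rightarrow> ereal \<Rightarrow> ereal" where
  "fp_v_aspect H lam \<theta> =
     (if \<theta> = \<infinity> then Lim at_top (\<lambda>t. fp_v_nonneg H lam t)
      else fp_v_nonneg H lam (real_of_ereal \<theta>))"

definition fp_v :: "real measure \<Rightarrow> ereal \<Rightarrow> ereal \<Rightarrow> ereal" where
  "fp_v H lam \<theta> =
     (if lam = \<infinity> then Lim at_top (\<lambda>l. fp_v_aspect H l \<theta>)
      else fp_v_aspect H (real_of_ereal lam) \<theta>)"

text \<open>Value at an extended \<open>v \<ge> 0\<close> of an expression given for real \<open>v > 0\<close>.\<close>

definition extend_by_limits :: "(real \<Rightarrow> real) \<Rightarrow> ereal \<Rightarrow> ereal" where
  "extend_by_limits f v =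
     (if v = 0 then Lim (at_right 0) (\<lambda>x. ereal (f x))
      else if v = \<infinity> then Lim at_top (\<lambda>x. ereal (f x))
      else ereal (f (real_of_ereal v)))"

definition fp_v_tilde :: "real measure \<Rightarrow> ereal \<Rightarrow> real \<Rightarrow> ereal \<Rightarrow> ereal" where
  "fp_v_tilde H lam \<theta>' \<theta> =
     extend_by_limits
       (\<lambda>v. (\<theta>' * (LINT r|H. r\<^sup>2 / (1 + v * r)\<^sup>2)) /
            (inverse (v\<^sup>2) - \<theta>' * (LINT r|H. r\<^sup>2 / (1 + v * r)\<^sup>2)))
       (fp_v H lam \<theta>)"

definition fp_c_tilde :: "real measure \<Rightarrow> real measure \<Rightarrow> ereal \<Rightarrow> ereal \<Rightarrow> ereal" where
  "fp_c_tilde H G lam \<theta> =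
     extend_by_limits (\<lambda>v. LINT r|G. r / (1 + v * r)\<^sup>2) (fp_v H lam \<theta>)"

text \<open>The only infinite value of \<open>fp_v_tilde\<close> occurs for \<open>v = \<infinity>\<close> and \<open>\<phi> = 1\<close>, where
  \<open>fp_c_tilde\<close> is \<open>0\<close> and the product \<open>(1 + v_tilde) * c_tilde\<close> has limit \<open>0\<close>; this agrees
  with \<open>\<infinity> * 0 = 0\<close> in \<open>ereal\<close>. Likewise \<open>\<sigma>\<^sup>2 * v_tilde\<close> is \<open>0\<close> there if \<open>\<sigma> = 0\<close>.\<close>

definition ensemble_risk ::
  "real measure \<Rightarrow> real measure \<Rightarrow> real \<Rightarrow> real \<Rightarrow> ereal \<Rightarrow> real \<Rightarrow> ereal \<Rightarrow> ereal" where
  "ensemble_risk H G \<rho> \<sigma> lam \<phi> \<phi>s =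
     ereal (\<sigma>\<^sup>2)
     + ereal (\<rho>\<^sup>2) * (1 + fp_v_tilde H lam \<phi> \<phi>s) * fp_c_tilde H G lam \<phi>s
     + ereal (\<sigma>\<^sup>2) * fp_v_tilde H lam \<phi> \<phi>s"

end

(* The risk depends on (lam, phi_s) only through v = v(-lam; phi_s). Multiplying the fixed-point
   equation by v turns it into lam * v + phi_s * F v = 1 with F v the H-integral of
   v r / (1 + v r); for fixed v this is an affine equation in (lam, phi_s). The level sets of v are
   therefore line segments, and lam_bar is where the segment through (0, phi_s_bar) meets
   phi_s = phi. In the degenerate cases v is infinite on the segment (phi_s_bar <= 1, with
   lam_bar = 0) or zero on it (phi_s_bar infinite, with lam_bar infinite). *)
theory Submission
  imports Defs
begin

section \<open>Positivity of the limiting spectrum\<close>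

text \<open>The eigenvalues stay above some \<open>a > 0\<close>, so the empirical distribution
  functions vanish below \<open>a\<close>. Weak convergence transfers this only at continuity points
  of \<open>cdf H\<close>; one lies in (0, a) because a monotone function has countably many
  discontinuities.\<close>

lemma (in feature_model) AE_H_pos: "AE x in H. 0 < x"
proof -
  interpret H: real_distribution H by (rule H_distribution)
  obtain a where a: "0 < a" "\<And>n j. j < p n \<Longrightarrow> a \<le> r n j"
    using r_bounds by blast
  have "countable {x. \<not> isCont (cdf H) x}"
    by (intro mono_ctble_discont monoI H.cdf_nondecreasing)
  then obtain x where x: "0 < x" "x < a" "isCont (cdf H) x"
    using uncountable_open_interval[of 0 a] a(1) countable_subset[of "{0<..<a}" "{x. \<not> isCont (cdf H) x}"]
    by (auto simp: subset_iff)
  have conv: "weak_conv (\<lambda>n. emp_spectral_cdf (p n) (r n)) (cdf H)"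
    using H_limit by (simp add: AE_const)
  have emp_zero: "emp_spectral_cdf (p n) (r n) x = 0" for n
    using x a(2)[of _ n] unfolding emp_spectral_cdf_def by (force intro!: sum.neutral)
  have "(\<lambda>n. emp_spectral_cdf (p n) (r n) x) \<longlonglongrightarrow> cdf H x"
    using conv x(3) by (simp add: weak_conv_def)
  then have "cdf H x = 0"
    by (simp add: emp_zero LIMSEQ_const_iff)
  then have "cdf H 0 = 0"
    using H.cdf_nondecreasing[of 0 x] x H.cdf_nonneg[of 0] by simp
  then have "emeasure H {..0} = 0"
    by (simp add: cdf_def H.emeasure_eq_measure)
  then show ?thesis
    by (intro AE_I[of _ _ "{..0}"]) (auto simp: not_less)
qed

text \<open>Real bounds \<open>e\<close> suffice because a real number lies between 0 and any
  positive extended real. This evaluates the limits that define v at infinite arguments.\<close>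

lemma Lim_eq_zero_erealI:
  fixes f :: "real \<Rightarrow> ereal"
  assumes "\<And>e::real. 0 < e \<Longrightarrow> eventually (\<lambda>x. 0 \<le> f x \<and> f x < ereal e) at_top"
  shows "Lim at_top f = 0"
proof (rule tendsto_Lim)
  show "(f \<longlongrightarrow> 0) at_top"
  proof (rule order_tendstoI)
    fix a :: ereal assume "a < 0"
    show "eventually (\<lambda>x. a < f x) at_top"
      using assms[of 1, OF less_numeral_extra(1)]
      by eventually_elim (rule less_le_trans[OF \<open>a < 0\<close> conjunct1])
  next
    fix a :: ereal assume "0 < a"
    from ereal_dense2[OF this] obtain e where e: "0 < ereal e" "ereal e < a"
      by (elim exE conjE)
    then have "0 < e" by simp
    show "eventually (\<lambda>x. f x < a) at_top"
      using assms[OF \<open>0 < e\<close>]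
      by eventually_elim (rule less_trans[OF conjunct2 e(2)])
  qed
qed simp

section \<open>The scaled integral and its monotonicity\<close>

locale positive_distribution = real_distribution H for H :: "real measure" +
  assumes AE_pos: "AE x in H. 0 < x"
begin

text \<open>The factor v keeps the integrand in [0, 1) on the positive reals, so the constant 1
  serves both for integrability and for dominated convergence.\<close>

definition F :: "real \<Rightarrow> real"
  where "F v = (LINT r|H. v * r / (1 + v * r))"

lemma integrand_bounds:
  fixes v r :: real
  assumes "0 \<le> v" "0 < r"
  shows "0 \<le> v * r / (1 + v * r)" "v * r / (1 + v * r) < 1"
  using assms by (auto simp: divide_simps add_pos_nonneg add_nonneg_pos)

lemma integrand_norm_le:
  fixes v r :: real
  assumes "0 \<le> v" "0 < r"
  shows "norm (v * r / (1 + v * r)) \<le> 1"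
  using integrand_bounds[OF assms] by (simp only: real_norm_def abs_of_nonneg less_imp_le)

lemma F_integrable:
  assumes "0 \<le> v"
  shows "integrable H (\<lambda>r. v * r / (1 + v * r))"
proof (rule integrable_const_bound[where B = 1])
  show "AE r in H. norm (v * r / (1 + v * r)) \<le> 1"
    using AE_pos by eventually_elim (rule integrand_norm_le[OF assms])
qed measurable

lemma F_less_one:
  assumes "0 \<le> v"
  shows "F v < 1"
proof -
  have "F v < (LINT r|H. 1)"
    unfolding F_def
  proof (rule integral_less_AE_space)
    show "AE r in H. v * r / (1 + v * r) < 1"
      using AE_pos by eventually_elim (rule integrand_bounds(2)[OF assms])
  qed (use F_integrable[OF assms] emeasure_space_1 in auto)
  then show ?thesis using prob_space by simp
qed

lemma F_strict_mono:
  assumes "0 \<le> u" "u < v"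
  shows "F u < F v"
  unfolding F_def
proof (rule integral_less_AE_space)
  show "AE r in H. u * r / (1 + u * r) < v * r / (1 + v * r)"
    using AE_pos
  proof eventually_elim
    case (elim r)
    have "0 < 1 + u * r" "0 < 1 + v * r"
      using assms elim by (simp_all add: add_pos_nonneg)
    then show ?case
      using assms elim by (simp add: divide_simps algebra_simps)
  qed
qed (use assms F_integrable emeasure_space_1 in auto)

lemma F_zero: "F 0 = 0"
  by (simp add: F_def)

lemma F_mono:
  assumes "0 \<le> u" "u \<le> v"
  shows "F u \<le> F v"
  using F_strict_mono[of u v] assms by (cases "u = v") auto

lemma F_pos:
  assumes "0 < v"
  shows "0 < F v"
  using F_strict_mono[of 0 v] F_zero assms by simp

lemma F_continuous: "continuous_on {0..} F"
  unfolding continuous_on_sequentially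
proof (intro allI ballI impI; elim conjE)
  fix u :: "nat \<Rightarrow> real" and a
  assume a: "a \<in> {0..}" and u: "\<forall>n. u n \<in> {0..}" "u \<longlonglongrightarrow> a"
  have "(\<lambda>n. F (u n)) \<longlonglongrightarrow> F a"
    unfolding F_def
  proof (rule integral_dominated_convergence[where w = "\<lambda>_. 1"])
    show "AE r in H. (\<lambda>n. u n * r / (1 + u n * r)) \<longlonglongrightarrow> a * r / (1 + a * r)"
      using AE_pos
    proof eventually_elim
      case (elim r)
      have "0 \<le> a * r"
        using a elim by simp
      then have "1 + a * r \<noteq> 0"
        by linarith
      then show ?case
        using u(2) by (intro tendsto_intros)
    qed
    show "AE r in H. norm (u n * r / (1 + u n * r)) \<le> 1" for n
      using AE_pos by eventually_elim (use u(1) integrand_norm_le in auto)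
  qed auto
  then show "(F \<circ> u) \<longlonglongrightarrow> F a" by (simp add: comp_def)
qed

text \<open>Pointwise convergence to 1 needs r > 0. At zero penalty this limit makes the equation
  solvable for every aspect ratio above 1.\<close>

lemma F_tendsto_one: "(\<lambda>n. F (real n)) \<longlonglongrightarrow> 1"
proof -
  have "(\<lambda>n. F (real n)) \<longlonglongrightarrow> (LINT r|H. 1)"
    unfolding F_def
  proof (rule integral_dominated_convergence[where w = "\<lambda>_. 1"])
    show "AE r in H. (\<lambda>n. real n * r / (1 + real n * r)) \<longlonglongrightarrow> 1"
      using AE_pos
    proof eventually_elim
      case (elim r)
      then show ?case by real_asymp
    qed
    show "AE r in H. norm (real n * r / (1 + real n * r)) \<le> 1" for n
      using AE_pos by eventually_elim (rule integrand_norm_le[OF of_nat_0_le_iff])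
  qed auto
  then show ?thesis using prob_space by simp
qed

section \<open>Roots of the scaled equation\<close>

lemma scaled_equation_unique:
  assumes "0 \<le> lam" "0 < \<theta>" "0 \<le> u" "0 \<le> v"
    and "lam * u + \<theta> * F u = 1" "lam * v + \<theta> * F v = 1"
  shows "u = v"
proof -
  have "lam * a + \<theta> * F a < lam * b + \<theta> * F b" if "0 \<le> a" "a < b" for a b
    using assms(1,2) that F_strict_mono[OF that]
    by (intro add_le_less_mono mult_left_mono mult_strict_left_mono) auto
  with assms show ?thesis
    by (metis linorder_neqE_linordered_idom less_irrefl)
qed

text \<open>Intermediate value theorem: the left side vanishes at v = 0, so only a point where it
  reaches 1 has to be found.\<close>

lemma scaled_equation_solvable:
  assumes "0 \<le> lam" "0 < \<theta>" "0 < lam \<or> 1 < \<theta>"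
  obtains v where "0 < v" "lam * v + \<theta> * F v = 1"
proof -
  let ?g = "\<lambda>v. lam * v + \<theta> * F v"
  \<comment> \<open>For a positive penalty the linear term alone is 1 at \<open>1 / lam\<close>.
    Otherwise \<open>\<theta> > 1\<close>, and \<open>F\<close> eventually exceeds
    \<open>1 / \<theta>\<close>.\<close>
  obtain b where b: "0 \<le> b" "1 \<le> ?g b"
  proof (cases "0 < lam")
    case True
    then have "1 \<le> ?g (1 / lam)"
      using assms(2) F_pos[of "1 / lam"] by simp
    then show ?thesis using that[of "1 / lam"] True by simp
  next
    case False
    then have "1 < \<theta>" using assms by simp
    then have "eventually (\<lambda>n. 1 / \<theta> < F (real n)) sequentially"
      using order_tendstoD(1)[OF F_tendsto_one, of "1 / \<theta>"] by simp
    then obtain n where "1 / \<theta> < F (real n)"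
      by (auto simp: eventually_sequentially)
    then have "1 \<le> \<theta> * F (real n)"
      using assms(2) by (simp add: field_simps)
    then have "1 \<le> ?g (real n)"
      using mult_nonneg_nonneg[OF assms(1), of "real n"] by simp
    then show ?thesis using that[of "real n"] by simp
  qed
  have "continuous_on {0..b} ?g"
    by (intro continuous_intros continuous_on_subset[OF F_continuous]) auto
  then obtain v where v: "0 \<le> v" "?g v = 1"
    using IVT'[of ?g 0 1 b] b F_zero by auto
  then have "v \<noteq> 0"
    using F_zero by auto
  with v(1) have "0 < v" by simp
  with v(2) show ?thesis using that by blast
qed

section \<open>The quantity v at finite arguments\<close>

lemma fixed_point_iff:
  assumes "0 < lam" "0 < \<theta>"
  shows "0 \<le> v \<and> inverse v = lam + \<theta> * (LINT r|H. r / (1 + v * r)) \<longleftrightarrow>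
    0 < v \<and> lam * v + \<theta> * F v = 1"
proof (cases "v = 0")
  case True
  (* inverse 0 = 0, and v = 0 is no solution even if r is not integrable and its integral reads 0. *)
  have "lam + \<theta> * (LINT r|H. r) \<noteq> 0"
    using assms AE_pos
    by (intro less_imp_neq[symmetric] add_pos_nonneg mult_nonneg_nonneg integral_nonneg_AE) auto
  with True show ?thesis by simp
next
  case False
  have "F v = v * (LINT r|H. r / (1 + v * r))"
    unfolding F_def by (subst integral_mult_right_zero[symmetric]) simp
  then have "lam * v + \<theta> * F v = v * (lam + \<theta> * (LINT r|H. r / (1 + v * r)))"
    by (simp add: algebra_simps)
  moreover have "inverse v = c \<longleftrightarrow> v * c = 1" for c
    using False by (metis inverse_unique right_inverse)
  ultimately show ?thesis
    using False by (simp add: order_less_le)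
qed

lemma fp_v_pos_eq:
  assumes "0 < lam" "0 < \<theta>" "0 < v" "lam * v + \<theta> * F v = 1"
  shows "fp_v_pos H lam \<theta> = v"
  unfolding fp_v_pos_def fixed_point_iff[OF assms(1,2)]
proof (rule the_equality)
  fix u assume u: "0 < u \<and> lam * u + \<theta> * F u = 1"
  show "u = v"
    by (rule scaled_equation_unique[of lam \<theta>]) (use u assms in simp_all)
qed (use assms in simp)

text \<open>The root u for penalty l > 0 has \<open>\<theta> * F u = 1 - l * u < 1\<close>, hence u
  < v. Any positive b < v makes the left side less than 1 once l is small, so the root then exceeds
  b.\<close>

lemma fp_v_pos_tendsto:
  assumes "0 < \<theta>" "0 < v" "\<theta> * F v = 1"
  shows "((\<lambda>l. fp_v_pos H l \<theta>) \<longlongrightarrow> v) (at_right 0)"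
proof -
  have bounds: "0 < fp_v_pos H l \<theta>" "fp_v_pos H l \<theta> < v"
    "l * fp_v_pos H l \<theta> + \<theta> * F (fp_v_pos H l \<theta>) = 1" if l: "0 < l" for l
  proof -
    obtain u where u: "0 < u" "l * u + \<theta> * F u = 1"
      using scaled_equation_solvable[of l \<theta>] l assms by auto
    then have "\<theta> * F u < \<theta> * F v"
      using l assms mult_pos_pos[OF l u(1)] by linarith
    then have "u < v"
      using F_mono[of v u] assms mult_left_mono[of "F v" "F u" \<theta>] by linarith
    then show "0 < fp_v_pos H l \<theta>" "fp_v_pos H l \<theta> < v"
      "l * fp_v_pos H l \<theta> + \<theta> * F (fp_v_pos H l \<theta>) = 1"
      using u fp_v_pos_eq[OF l assms(1) u] by auto
  qed
  show ?thesis
  proof (rule order_tendstoI)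
    fix a assume "v < a"
    then show "eventually (\<lambda>l. fp_v_pos H l \<theta> < a) (at_right 0)"
      using less_trans[OF bounds(2)] by (intro eventually_at_rightI[of 0 1]) auto
  next
    fix a assume "a < v"
    \<comment> \<open>The given a may be negative; the maximum with \<open>v / 2\<close> moves to
      the positive range, where \<open>F\<close> is known to be monotone.\<close>
    define b where "b = max a (v / 2)"
    have b: "0 < b" "b < v" "a \<le> b"
      using \<open>a < v\<close> assms(2) by (auto simp: b_def)
    have Fb: "\<theta> * F b < 1"
      using F_strict_mono[of b v] b assms by (metis less_imp_le mult_strict_left_mono)
    show "eventually (\<lambda>l. a < fp_v_pos H l \<theta>) (at_right 0)"
    \<comment> \<open>This bound is the penalty l at which \<open>l * b + \<theta> * F b\<close>
      equals 1.\<close>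
    proof (rule eventually_at_rightI[of 0 "(1 - \<theta> * F b) / b"])
      show "0 < (1 - \<theta> * F b) / b" using Fb b by simp
    next
      fix l assume "l \<in> {0<..<(1 - \<theta> * F b) / b}"
      then have l: "0 < l" "l * b + \<theta> * F b < 1"
        using b by (auto simp: field_simps)
      have "\<not> fp_v_pos H l \<theta> \<le> b"
      proof
        assume le: "fp_v_pos H l \<theta> \<le> b"
        have "l * fp_v_pos H l \<theta> + \<theta> * F (fp_v_pos H l \<theta>) \<le> l * b + \<theta> * F b"
          using l assms bounds[OF l(1)] le
          by (intro add_mono mult_left_mono F_mono) auto
        then show False using bounds(3)[OF l(1)] l by simp
      qed
      then show "a < fp_v_pos H l \<theta>" using b by simp
    qed
  qed
qed

lemma fp_v_nonneg_eq:
  assumes "0 \<le> lam" "0 < \<theta>" "0 < v" "lam * v + \<theta> * F v = 1"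
  shows "fp_v_nonneg H lam \<theta> = ereal v"
proof (cases "0 < lam")
  case True
  then show ?thesis using fp_v_pos_eq[OF True assms(2-4)] by (simp add: fp_v_nonneg_def)
next
  case False
  then have eq: "lam = 0" "\<theta> * F v = 1" using assms by auto
  \<comment> \<open>Since \<open>F v < 1\<close>, the equation forces the limit branch of
    \<open>fp_v_nonneg\<close> rather than the infinite one.\<close>
  then have "1 < \<theta>"
    using F_less_one[of v] assms by (metis less_imp_le mult.right_neutral mult_strict_left_mono)
  moreover have "((\<lambda>l. ereal (fp_v_pos H l \<theta>)) \<longlongrightarrow> ereal v) (at_right 0)"
    by (intro tendsto_ereal fp_v_pos_tendsto[OF assms(2,3) eq(2)])
  then have "Lim (at_right 0) (\<lambda>l. ereal (fp_v_pos H l \<theta>)) = ereal v"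
    by (intro tendsto_Lim) auto
  ultimately show ?thesis using eq by (simp add: fp_v_nonneg_def)
qed

section \<open>The quantity v at infinite arguments\<close>

text \<open>By monotonicity the root lies below every \<open>e\<close> at which the left side
  already exceeds 1. Either summand can be made to do so by enlarging its coefficient, which is how
  both infinite limits are treated.\<close>

lemma fp_v_nonneg_bounds:
  assumes "0 \<le> lam" "0 < \<theta>" "0 < lam \<or> 1 < \<theta>" "0 < e" "1 < lam * e + \<theta> * F e"
  shows "0 \<le> fp_v_nonneg H lam \<theta> \<and> fp_v_nonneg H lam \<theta> < ereal e"
proof -
  obtain v where v: "0 < v" "lam * v + \<theta> * F v = 1"
    by (rule scaled_equation_solvable[OF assms(1-3)])
  have "v < e"
  proof (rule ccontr)
    assume "\<not> v < e"
    then have "e \<le> v" by simp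
    then have "F e \<le> F v" using assms(4) by (intro F_mono) simp_all
    then have "\<theta> * F e \<le> \<theta> * F v" using assms(2) by simp
    moreover have "lam * e \<le> lam * v"
      using \<open>e \<le> v\<close> assms(1) by (rule mult_left_mono)
    ultimately show False using assms(5) v(2) by linarith
  qed
  then show ?thesis
    unfolding fp_v_nonneg_eq[OF assms(1,2) v] using v(1) by simp
qed

lemma fp_v_aspect_infinity:
  assumes "0 \<le> lam"
  shows "fp_v_aspect H lam \<infinity> = 0"
proof -
  have "eventually (\<lambda>t. 0 \<le> fp_v_nonneg H lam t \<and> fp_v_nonneg H lam t < ereal e) at_top"
    if e: "0 < e" for e
    \<comment> \<open>The first threshold ensures solvability even for \<open>lam = 0\<close>; the
      second makes \<open>t * F e > 1\<close>.\<close>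
    using eventually_gt_at_top[of 1] eventually_gt_at_top[of "1 / F e"]
  proof eventually_elim
    case (elim t)
    have "1 < t * F e" using elim(2) F_pos[OF e] by (simp add: field_simps)
    moreover have "0 \<le> lam * e" using assms e by simp
    ultimately have "1 < lam * e + t * F e" by linarith
    then show ?case
      using assms e elim(1) by (intro fp_v_nonneg_bounds) simp_all
  qed
  then have "Lim at_top (\<lambda>t. fp_v_nonneg H lam t) = 0"
    by (rule Lim_eq_zero_erealI)
  then show ?thesis
    by (simp add: fp_v_aspect_def)
qed

lemma fp_v_infinity_left:
  assumes "0 < \<theta>"
  shows "fp_v H \<infinity> \<theta> = 0"
proof (cases "\<theta> = \<infinity>")
  case True
  have "Lim at_top (\<lambda>l. fp_v_aspect H l \<infinity>) = 0"
  proof (rule Lim_eq_zero_erealI)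
    fix e :: real assume e: "0 < e"
    show "eventually (\<lambda>l. 0 \<le> fp_v_aspect H l \<infinity> \<and> fp_v_aspect H l \<infinity> < ereal e) at_top"
      using eventually_ge_at_top[of 0] by eventually_elim (use e in \<open>simp add: fp_v_aspect_infinity\<close>)
  qed
  then show ?thesis using True by (simp add: fp_v_def)
next
  case False
  then obtain t where t: "\<theta> = ereal t" "0 < t"
    using assms by (cases \<theta>) auto
  have "Lim at_top (\<lambda>l. fp_v_nonneg H l t) = 0"
  proof (rule Lim_eq_zero_erealI)
    fix e :: real assume e: "0 < e"
    show "eventually (\<lambda>l. 0 \<le> fp_v_nonneg H l t \<and> fp_v_nonneg H l t < ereal e) at_top"
      using eventually_gt_at_top[of "1 / e"]
    proof eventually_elim
      case (elim l)
      have "0 < 1 / e" using e by simp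
      then have l: "0 < l" using elim by linarith
      have "1 < l * e" using elim e by (simp add: field_simps)
      moreover have "0 < t * F e" using t(2) F_pos[OF e] by simp
      ultimately have "1 < l * e + t * F e" by linarith
      then show ?case
        using e t(2) l by (intro fp_v_nonneg_bounds) simp_all
    qed
  qed
  then show ?thesis using t by (simp add: fp_v_def fp_v_aspect_def)
qed

lemma fp_v_infinity_right: "0 \<le> lam \<Longrightarrow> fp_v H lam \<infinity> = 0"
  using fp_v_infinity_left[of \<infinity>] fp_v_aspect_infinity[of "real_of_ereal lam"]
  by (cases lam) (auto simp: fp_v_def)

section \<open>Constancy of v along the segment\<close>

lemma fp_v_constant_on_segment:
  assumes "0 < \<phi>" "ereal \<phi> \<le> \<phi>s"
  obtains lam_bar v where "0 \<le> lam_bar" "\<phi>s \<noteq> \<infinity> \<Longrightarrow> lam_bar \<noteq> \<infinity>"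
    and "\<And>\<theta>. \<theta> \<in> {0..1} \<Longrightarrow> fp_v H (ereal (1 - \<theta>) * lam_bar + ereal \<theta> * 0)
           (ereal (1 - \<theta>) * ereal \<phi> + ereal \<theta> * \<phi>s) = v"
proof (cases \<phi>s)
  case PInf
  show ?thesis
  proof (rule that[of \<infinity> 0])
    fix \<theta> :: real assume \<theta>: "\<theta> \<in> {0..1}"
    show "fp_v H (ereal (1 - \<theta>) * \<infinity> + ereal \<theta> * 0)
        (ereal (1 - \<theta>) * ereal \<phi> + ereal \<theta> * \<phi>s) = 0"
    \<comment> \<open>In \<open>ereal\<close>, \<open>0 * \<infinity> = 0\<close>. So at
      \<open>\<theta> = 0\<close> the aspect ratio is the finite \<open>\<phi>\<close> with infinite
      penalty, while for \<open>\<theta> > 0\<close> the aspect ratio is infinite and any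
      nonnegative penalty, including 0 at \<open>\<theta> = 1\<close>, gives v = 0.\<close>
    proof (cases "\<theta> = 0")
      case True
      then show ?thesis using assms PInf fp_v_infinity_left by simp
    next
      case False
      then have "ereal (1 - \<theta>) * ereal \<phi> + ereal \<theta> * \<phi>s = \<infinity>"
        using \<theta> PInf by simp
      moreover have "0 \<le> ereal (1 - \<theta>) * \<infinity> + ereal \<theta> * 0"
        using \<theta> by simp
      ultimately show ?thesis by (simp only: fp_v_infinity_right)
    qed
  qed (use PInf in auto)
next
  case MInf
  then show ?thesis using assms by simp
next
  case (real s)
  then have s: "\<phi> \<le> s" using assms by simp
  have path: "0 < (1 - \<theta>) * \<phi> + \<theta> * s" if "\<theta> \<in> {0..1}" for \<theta>
  proof -
    have "\<phi> \<le> (1 - \<theta>) * \<phi> + \<theta> * s"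
      using mult_left_mono[OF s, of \<theta>] that by (simp add: algebra_simps)
    then show ?thesis using assms by simp
  qed
  show ?thesis
  proof (cases "1 < s")
    case False
    show ?thesis
    \<comment> \<open>The penalty is 0 and the aspect ratio at most 1 on the whole segment, which is
      the branch where v is infinite by definition.\<close>
    proof (rule that[of 0 \<infinity>])
      fix \<theta> :: real assume \<theta>: "\<theta> \<in> {0..1}"
      have "(1 - \<theta>) * \<phi> + \<theta> * s \<le> 1"
        using False s \<theta> by (intro convex_bound_le) auto
      then show "fp_v H (ereal (1 - \<theta>) * 0 + ereal \<theta> * 0)
          (ereal (1 - \<theta>) * ereal \<phi> + ereal \<theta> * \<phi>s) = \<infinity>"
        using real by (simp add: fp_v_def fp_v_aspect_def fp_v_nonneg_def)
    qed auto
  next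
    case True
    then obtain v where v: "0 < v" "s * F v = 1"
      using scaled_equation_solvable[of 0 s] by auto
    \<comment> \<open>The penalty that gives the same root v at aspect ratio \<open>\<phi>\<close>;
      it is nonnegative because \<open>\<phi> * F v \<le> s * F v = 1\<close>.\<close>
    define l where "l = (1 - \<phi> * F v) / v"
    have "\<phi> * F v \<le> s * F v"
      using s F_pos[OF v(1)] by (intro mult_right_mono) auto
    then have l: "0 \<le> l" "l * v + \<phi> * F v = 1"
      using v by (auto simp: l_def)
    show ?thesis
    proof (rule that[of "ereal l" "ereal v"])
      fix \<theta> :: real assume \<theta>: "\<theta> \<in> {0..1}"
      \<comment> \<open>A convex combination of the equations at the two endpoints, both with the
        same v.\<close>
      have "(1 - \<theta>) * l * v + ((1 - \<theta>) * \<phi> + \<theta> * s) * F v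
          = (1 - \<theta>) * (l * v + \<phi> * F v) + \<theta> * (s * F v)"
        by (simp add: algebra_simps)
      also have "\<dots> = 1" by (simp add: l v)
      finally have "fp_v_nonneg H ((1 - \<theta>) * l) ((1 - \<theta>) * \<phi> + \<theta> * s) = ereal v"
        using path[OF \<theta>] \<theta> l v by (intro fp_v_nonneg_eq) auto
      then show "fp_v H (ereal (1 - \<theta>) * ereal l + ereal \<theta> * 0)
          (ereal (1 - \<theta>) * ereal \<phi> + ereal \<theta> * \<phi>s) = ereal v"
        using real by (simp add: fp_v_def fp_v_aspect_def)
    qed (use l in auto)
  qed
qed

end

theorem mainTheorem2:
  fixes M :: "'a measure"
    and p :: "nat \<Rightarrow> nat"
    and Z X :: "nat \<Rightarrow> 'a \<Rightarrow> real mat"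
    and Sig :: "nat \<Rightarrow> real mat"
    and r :: "nat \<Rightarrow> nat \<Rightarrow> real"
    and w :: "nat \<Rightarrow> nat \<Rightarrow> real vec"
    and \<beta>0 :: "nat \<Rightarrow> real vec"
    and \<epsilon> y :: "nat \<Rightarrow> 'a \<Rightarrow> real vec"
    and H G :: "real measure"
    and \<rho> \<sigma> \<phi> :: real
    and \<phi>s_bar :: ereal
  assumes "feature_model M p Z Sig r w X H"
    and "response_model M p Z Sig r w X H \<beta>0 \<epsilon> y G \<rho> \<sigma>"
    and "0 < \<phi>"
    and "ereal \<phi> \<le> \<phi>s_bar"
  shows "\<exists>lam_bar :: ereal. 0 \<le> lam_bar \<and> (\<phi>s_bar \<noteq> \<infinity> \<longrightarrow> lam_bar \<noteq> \<infinity>) \<and>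
    ensemble_risk H G \<rho> \<sigma> 0 \<phi> \<phi>s_bar = ensemble_risk H G \<rho> \<sigma> lam_bar \<phi> (ereal \<phi>) \<and>
    (\<lambda>\<theta>::real. ensemble_risk H G \<rho> \<sigma>
        (ereal (1 - \<theta>) * lam_bar + ereal \<theta> * 0) \<phi>
        (ereal (1 - \<theta>) * ereal \<phi> + ereal \<theta> * \<phi>s_bar)) constant_on {0..1}"
proof -
  interpret feature_model M p Z Sig r w X H by (rule assms(1))
  interpret H: real_distribution H by (rule H_distribution)
  interpret H: positive_distribution H
    by unfold_locales (rule AE_H_pos)
  obtain lam_bar v where lam: "0 \<le> lam_bar" "\<phi>s_bar \<noteq> \<infinity> \<Longrightarrow> lam_bar \<noteq> \<infinity>"
    and v: "\<And>\<theta>. \<theta> \<in> {0..1} \<Longrightarrow> fp_v H (ereal (1 - \<theta>) * lam_bar + ereal \<theta> * 0)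
           (ereal (1 - \<theta>) * ereal \<phi> + ereal \<theta> * \<phi>s_bar) = v"
    using H.fp_v_constant_on_segment[OF assms(3,4)] by blast
  have "fp_v H 0 \<phi>s_bar = fp_v H lam_bar (ereal \<phi>)"
    \<comment> \<open>The two ends of the segment: \<open>\<theta> = 0\<close> gives the full-sample
      ridge side, \<open>\<theta> = 1\<close> the ridgeless side.\<close>
    using v[of 0] v[of 1] by (simp add: zero_ereal_def[symmetric] one_ereal_def[symmetric])
  then have "ensemble_risk H G \<rho> \<sigma> 0 \<phi> \<phi>s_bar = ensemble_risk H G \<rho> \<sigma> lam_bar \<phi> (ereal \<phi>)"
    by (simp add: ensemble_risk_def fp_v_tilde_def fp_c_tilde_def)
  moreover have "(\<lambda>\<theta>::real. ensemble_risk H G \<rho> \<sigma>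
        (ereal (1 - \<theta>) * lam_bar + ereal \<theta> * 0) \<phi>
        (ereal (1 - \<theta>) * ereal \<phi> + ereal \<theta> * \<phi>s_bar)) constant_on {0..1}"
    unfolding constant_on_def ensemble_risk_def fp_v_tilde_def fp_c_tilde_def
    \<comment> \<open>The equation \<open>v\<close> is conditional on \<open>\<theta>\<close> in
      [0, 1]; the congruence rule supplies that membership. The rewritten risk no longer mentions
      \<open>\<theta>\<close>, so it is its own constant value.\<close>
    by (simp only: v cong: ball_cong) blast
  ultimately show ?thesis using lam by blast
qed

end
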